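(* Let $n\geq 2$, $1\leq k\leq n-1$, and $q=p^h$ with $p$ prime and $h\geq 1$. If $p=7$, there is no codeword of $\mathrm{C}_k(n,q)$ with weight in the open interval $]\theta_k, (12\theta_k+2)/7[$. If $p>7$, there is no codeword of $\mathrm{C}_k(n,q)$ with weight in the open interval $]\theta_k,(12\theta_k+6)/7[$.
   Context: $\mathrm{PG}(n,q)$ is the $n$-dimensional projective space over $\mathbb{F}_q$, $q=p^h$; $\theta_m=(q^{m+1}-1)/(q-1)$. $\mathrm{C}_k(n,q)$ is the $p$-ary linear code (a subspace of $\mathbb{F}_p^{\theta_n}$, coordinates indexed by the points of $\mathrm{PG}(n,q)$) spanned over $\mathbb{F}_p$ by the incidence vectors of the $k$-dimensional subspaces of $\mathrm{PG}(n,q)$. The weight of a vector is its number of nonzero coordinates. *)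

theory Defs
  imports "HOL-Analysis.Analysis"
begin

text \<open>PG(n,q) is modelled on the vector space 'a^'n over the finite field 'a,
  where CARD('n) = n+1.  Points are 1-dimensional linear subspaces; a projective
  k-space is a (k+1)-dimensional linear subspace, identified with the set of
  points it contains.\<close>

definition theta :: "nat \<Rightarrow> nat \<Rightarrow> nat" where
  "theta q m = (q ^ (m + 1) - 1) div (q - 1)"

definition PG_points :: "('a::field ^ 'n::finite) set set" where
  "PG_points = {vec.span {v} | v. v \<noteq> 0}"

definition PG_subspaces :: "nat \<Rightarrow> ('a::field ^ 'n::finite) set set set" where
  "PG_subspaces k = {{P \<in> PG_points. P \<subseteq> W} | W. vec.subspace W \<and> vec.dim W = k + 1}"

definition incvec :: "('a::field ^ 'n::finite) set set \<Rightarrow> ('a ^ 'n) set \<Rightarrow> int" where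
  "incvec S P = (if P \<in> S then 1 else 0)"

text \<open>The p-ary code C_k(n,q): the F_p-span of the incidence vectors of the
  projective k-spaces.  Entries of F_p are represented by residues in {0..<p};
  an F_p-linear combination is an integer linear combination reduced mod p.
  Codewords are functions on PG_points (value 0 outside).\<close>
definition code :: "nat \<Rightarrow> nat \<Rightarrow> (('a::{finite,field} ^ 'n::finite) set \<Rightarrow> int) set" where
  "code p k = {(\<lambda>P. if P \<in> PG_points
                    then (\<Sum>S\<in>PG_subspaces k. a S * incvec S P) mod int p else 0)
              | a. True}"

definition weight :: "(('a::field ^ 'n::finite) set \<Rightarrow> int) \<Rightarrow> nat" where
  "weight c = card {P \<in> PG_points. c P \<noteq> 0}"

end

theory Submission
  imports Defs
begin

text \<open>A codeword of C_k(n,q) is read as a function g on the vector space of dimension n + 1 that is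
  constant on punctured lines through 0.  The indicator of a (k+1)-dimensional subspace is a
  polynomial function of degree (n-k)(q-1), hence so is g: it lies in a generalized Reed-Muller
  code, and its weight is (q-1)w or (q-1)w + 1, where w is the weight of the codeword.
  Functions of degree a(q-1) in N variables have weight q^(N-a) or at least
  2(q-1)q^(N-a-1); with N = n+1 and a = n-k this excludes every w strictly between
  theta_k and 2q^k, an interval that contains those of the theorem.

  For the gap in the Reed-Muller weights, expand f in powers of one variable.  If the coefficient of
  the power q-1 vanishes, the minimum distance shows that f does not depend on this variable.
  Otherwise this coefficient has degree (a-1)(q-1) and satisfies the claim by induction.  If a > 1,
  its support lies in a hyperplane, and the minimum distance forces the support of f into the same
  hyperplane.  If a = 1, the coefficient is a nonzero constant; if that happens for all directions
  in a plane, the support of f blocks all lines of the plane and is too large by Jamison's theorem.\<close>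

section \<open>Polynomial functions of bounded degree\<close>

text \<open>\<open>pdeg I D f\<close>: as a function, \<open>f\<close> is given by a polynomial of total degree at most \<open>D\<close>
  in the variables \<open>x i\<close> with \<open>i \<in> I\<close>.\<close>

inductive pdeg :: "'i set \<Rightarrow> nat \<Rightarrow> (('i \<Rightarrow> 'a::field) \<Rightarrow> 'a) \<Rightarrow> bool" for I where
  const: "pdeg I D (\<lambda>x. c)"
| add: "pdeg I D f \<Longrightarrow> pdeg I D g \<Longrightarrow> pdeg I D (\<lambda>x. f x + g x)"
| var: "i \<in> I \<Longrightarrow> pdeg I D f \<Longrightarrow> pdeg I (Suc D) (\<lambda>x. x i * f x)"

lemma pdeg_mono: "pdeg I D f \<Longrightarrow> D \<le> E \<Longrightarrow> I \<subseteq> J \<Longrightarrow> pdeg J E f"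
proof (induction arbitrary: E rule: pdeg.induct)
  case (var i D f)
  then obtain E' where "E = Suc E'" "D \<le> E'" by (cases E) auto
  with var show ?case by (auto intro: pdeg.var)
qed (auto intro: pdeg.intros)

lemma pdeg_mult:
  assumes "pdeg I D f" and g: "pdeg I E g"
  shows "pdeg I (D + E) (\<lambda>x. f x * g x)"
  using assms(1)
proof (induction rule: pdeg.induct)
  case (const D c)
  from g have "pdeg I E (\<lambda>x. c * g x)"
  proof (induction rule: pdeg.induct)
    case (var i D f)
    from pdeg.var[OF var(1) var(3)] show ?case by (simp add: mult.left_commute)
  qed (auto simp: distrib_left intro: pdeg.intros)
  then show ?case by (rule pdeg_mono) auto
next
  case (var i D f)
  from pdeg.var[OF var(1) var(3)] show ?case by (simp add: mult.assoc)
qed (auto simp: distrib_right intro: pdeg.intros)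

lemma pdeg_sum:
  "(\<And>s. s \<in> A \<Longrightarrow> pdeg I D (f s)) \<Longrightarrow> pdeg I D (\<lambda>x. \<Sum>s\<in>A. f s x)"
  by (induction A rule: infinite_finite_induct) (auto intro: pdeg.intros)

lemma pdeg_prod:
  "(\<And>s. s \<in> A \<Longrightarrow> pdeg I D (f s)) \<Longrightarrow> pdeg I (card A * D) (\<lambda>x. \<Prod>s\<in>A. f s x)"
proof (induction A rule: infinite_finite_induct)
  case (insert a A)
  then show ?case using pdeg_mult[of I D "f a" "card A * D" "\<lambda>x. \<Prod>s\<in>A. f s x"] by simp
qed (auto intro: pdeg.intros)

lemma pdeg_affine:
  fixes c :: "'i::finite \<Rightarrow> 'a::field"
  assumes "\<And>j. j \<notin> I \<Longrightarrow> c j = 0"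
  shows "pdeg I (Suc 0) (\<lambda>x. b + (\<Sum>j\<in>UNIV. c j * x j))"
proof -
  have "pdeg I (Suc 0) (\<lambda>x. c j * x j)" for j
  proof (cases "j \<in> I")
    case True
    then show ?thesis using pdeg.var[OF True pdeg.const[of I 0 "c j"]] by (simp add: mult.commute)
  qed (simp add: assms pdeg.const)
  then show ?thesis by (intro pdeg.add pdeg_sum pdeg.const)
qed

lemma pdeg_cong: "pdeg I D f \<Longrightarrow> (\<And>i. i \<in> I \<Longrightarrow> x i = y i) \<Longrightarrow> f x = f y"
  by (induction rule: pdeg.induct) simp_all

lemma pdeg_fun_upd: "pdeg I D f \<Longrightarrow> i \<notin> I \<Longrightarrow> f (x(i := t)) = f x"
  by (erule pdeg_cong) auto

lemma pdeg_0_const: "pdeg I D f \<Longrightarrow> D = 0 \<Longrightarrow> f x = f y"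
  by (induction rule: pdeg.induct) auto

text \<open>A linear substitution does not raise the degree. It carries statements about lines in
  direction \<open>i\<close> over to lines of slope \<open>c\<close> in the plane of
  \<open>i\<close> and \<open>j\<close>.\<close>

lemma pdeg_shear:
  assumes "pdeg I D f" "i \<in> I"
  shows "pdeg I D (\<lambda>x. f (x(j := x j + c * x i)))"
  using assms(1)
proof (induction rule: pdeg.induct)
  case (var k D f)
  show ?case
  proof (cases "k = j")
    case True
    have 1: "pdeg I (Suc D) (\<lambda>x. x j * f (x(j := x j + c * x i)))"
      using pdeg.var[OF var(1) var(3)] unfolding True .
    have 2: "pdeg I (0 + Suc D) (\<lambda>x. c * (x i * f (x(j := x j + c * x i))))"
      using pdeg_mult[OF pdeg.const pdeg.var[OF assms(2) var(3)]] .
    have "pdeg I (Suc D) (\<lambda>x. x j * f (x(j := x j + c * x i)) + c * (x i * f (x(j := x j + c * x i))))"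
      using pdeg.add[OF 1] 2 by simp
    then show ?thesis by (simp only: True fun_upd_same distrib_right mult.assoc)
  next
    case False
    then show ?thesis using pdeg.var[OF var(1) var(3)] by (simp only: fun_upd_other not_False_eq_True)
  qed
qed (auto intro: pdeg.intros)

section \<open>Expansion in one variable over a finite field\<close>

lemma card_field_ge_2: "CARD('a::{finite,field}) \<ge> 2"
proof -
  have "card {0, 1::'a} \<le> CARD('a)" by (rule card_mono) auto
  then show ?thesis by simp
qed

lemma power_card_field:
  fixes y :: "'a::{finite,field}"
  shows "y ^ CARD('a) = y"
proof (cases "y = 0")
  case False
  have "(\<Prod>z\<in>UNIV - {0}. y * z) = \<Prod>(UNIV - {0})"
    by (rule prod.reindex_bij_witness[of _ "\<lambda>z. z / y" "\<lambda>z. y * z"]) (use False in auto)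
  then have "y ^ (CARD('a) - 1) = 1"
    by (simp add: prod.distrib)
  then have "y * y ^ (CARD('a) - 1) = y" by simp
  then show ?thesis by (metis finite_UNIV_card_ge_0 finite_class.finite_UNIV power_minus_mult mult.commute)
qed (simp add: card_gt_0_iff)

text \<open>The relation \<open>y ^ q = y\<close> brings all exponents of \<open>x i\<close> below q
  without raising the degree. The clause for \<open>e > D\<close> is separate because
  \<open>D - e\<close> is truncated at 0 and would still admit nonzero constants.\<close>

lemma pdeg_expand:
  fixes f :: "('i \<Rightarrow> 'a::{finite,field}) \<Rightarrow> 'a"
  assumes "pdeg I D f"
  shows "\<exists>g. (\<forall>e. pdeg (I - {i}) (D - e) (g e)) \<and> (\<forall>e>D. g e = (\<lambda>x. 0)) \<and>
             (\<forall>x. f x = (\<Sum>e<CARD('a). x i ^ e * g e x))"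
  using assms
proof (induction rule: pdeg.induct)
  case (const D c)
  let ?g = "\<lambda>e x. if e = 0 then c else 0"
  have "(\<Sum>e<CARD('a). x i ^ e * ?g e x) = c" for x :: "'i \<Rightarrow> 'a"
  proof -
    have "(\<Sum>e<CARD('a). x i ^ e * ?g e x) = (\<Sum>e<CARD('a). if e = 0 then c else 0)"
      by (rule sum.cong) auto
    then show ?thesis by simp
  qed
  then show ?case by (intro exI[of _ ?g]) (auto intro: pdeg.const)
next
  case (add D f1 f2)
  then obtain g1 g2 where
    "\<forall>e. pdeg (I - {i}) (D - e) (g1 e)" "\<forall>e>D. g1 e = (\<lambda>x. 0)"
    "\<forall>x. f1 x = (\<Sum>e<CARD('a). x i ^ e * g1 e x)"
    "\<forall>e. pdeg (I - {i}) (D - e) (g2 e)" "\<forall>e>D. g2 e = (\<lambda>x. 0)"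
    "\<forall>x. f2 x = (\<Sum>e<CARD('a). x i ^ e * g2 e x)"
    by blast
  then show ?case
    by (intro exI[of _ "\<lambda>e x. g1 e x + g2 e x"])
       (auto intro: pdeg.add simp: distrib_left sum.distrib)
next
  case (var j D f)
  then obtain g where g: "\<And>e. pdeg (I - {i}) (D - e) (g e)" "\<And>e. e > D \<Longrightarrow> g e = (\<lambda>x. 0)"
    "\<And>x. f x = (\<Sum>e<CARD('a). x i ^ e * g e x)"
    by blast
  show ?case
  proof (cases "j = i")
    case False
    have "pdeg (I - {i}) (Suc D - e) (\<lambda>x. x j * g e x)" for e
    proof (cases "e \<le> D")
      case True
      then show ?thesis using pdeg.var[of j "I - {i}", OF _ g(1)[of e]] var(1) False
        by (simp add: Suc_diff_le)
    qed (simp add: g(2) pdeg.const)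
    then show ?thesis
      by (intro exI[of _ "\<lambda>e x. x j * g e x"])
         (auto simp: g(2,3) sum_distrib_left mult.left_commute)
  next
    case True
    \<comment> \<open>Multiplying by \<open>x i\<close> shifts the coefficients up by one; the top
      one reaches exponent q and wraps round to exponent 1.\<close>
    define h where "h e x = (if e = 0 then 0 else g (e - 1) x) +
      (if e = 1 then g (CARD('a) - 1) x else 0)" for e x
    have "pdeg (I - {i}) (Suc D - e) (h e)" for e
    proof -
      consider "e = 0" | "e = 1" | "e \<ge> 2" by linarith
      then show ?thesis
      proof cases
        case 1
        then show ?thesis unfolding h_def by (simp add: pdeg.const)
      next
        case 2
        have "pdeg (I - {i}) D (\<lambda>x. g 0 x + g (CARD('a) - 1) x)"
          using pdeg_mono[OF g(1)[of "CARD('a) - 1"], of D "I - {i}"] g(1)[of 0]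
          by (intro pdeg.add) (simp_all add: le_diff_conv)
        then show ?thesis using 2 unfolding h_def by simp
      next
        case 3
        then have "h e = g (e - 1)" unfolding h_def by auto
        with g(1)[of "e - 1"] 3 show ?thesis by (auto simp: Suc_diff_Suc Suc_diff_le)
      qed
    qed
    moreover have "h e = (\<lambda>x. 0)" if "e > Suc D" for e
      using that g(2)[of "e - 1"] unfolding h_def by auto
    moreover have "x i * f x = (\<Sum>e<CARD('a). x i ^ e * h e x)" for x
    proof -
      obtain r where r: "CARD('a) = Suc (Suc r)"
        using card_field_ge_2[where 'a='a] by (metis add_2_eq_Suc le_Suc_ex)
      have xq: "x i * x i ^ Suc r = x i"
        using power_card_field[of "x i"] r by simp
      have "x i * f x = (\<Sum>e<Suc r. x i ^ Suc e * g e x) + x i * x i ^ Suc r * g (Suc r) x"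
        unfolding g(3) r by (simp add: sum_distrib_left distrib_left mult.assoc)
      also have "\<dots> = (\<Sum>e<Suc r. x i ^ Suc e * g e x) + x i * g (Suc r) x"
        by (simp only: xq)
      also have "\<dots> = (\<Sum>e<Suc r. x i ^ Suc e * h (Suc e) x)"
        unfolding h_def r by (simp add: sum.lessThan_Suc_shift algebra_simps del: sum.lessThan_Suc)
      also have "\<dots> = (\<Sum>e<Suc (Suc r). x i ^ e * h e x)"
        by (subst sum.lessThan_Suc_shift[of _ "Suc r"]) (simp add: h_def)
      finally show ?thesis by (simp add: r)
    qed
    ultimately show ?thesis using True by (intro exI[of _ h]) auto
  qed
qed

text \<open>Any nonzero coefficient certifies that the polynomial is nonzero; \<open>d\<close> only
  bounds its degree, hence its number of roots.\<close>

lemma card_nonroots_ge: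
  fixes c :: "nat \<Rightarrow> 'a::{finite,field}"
  assumes "c k \<noteq> 0" "k \<le> d"
  shows "CARD('a) - d \<le> card {t. (\<Sum>e\<le>d. t ^ e * c e) \<noteq> 0}"
proof -
  define P where "P = (\<Sum>e\<le>d. monom (c e) e)"
  have "coeff P k = c k" unfolding P_def using assms(2) by (simp add: coeff_sum)
  then have "P \<noteq> 0" using assms(1) by auto
  moreover have "degree P \<le> d" unfolding P_def
    by (intro degree_sum_le) (auto intro: order.trans[OF degree_monom_le])
  ultimately have "card {t. poly P t = 0} \<le> d" using card_poly_roots_bound[of P] by linarith
  moreover have "poly P t = (\<Sum>e\<le>d. t ^ e * c e)" for t
    unfolding P_def by (simp add: poly_sum poly_monom mult.commute)
  moreover have "{t. (\<Sum>e\<le>d. t ^ e * c e) \<noteq> 0} = UNIV - {t. (\<Sum>e\<le>d. t ^ e * c e) = 0}" by auto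
  ultimately show ?thesis by (simp add: card_Diff_subset)
qed

section \<open>Weights, leading coefficients and the minimum distance\<close>

abbreviation wt :: "('b::finite \<Rightarrow> 'a::zero) \<Rightarrow> nat" where
  "wt f \<equiv> card {x. f x \<noteq> 0}"

lemma sum_fibres:
  fixes h :: "('i::finite \<Rightarrow> 'a::finite) \<Rightarrow> nat"
  shows "(\<Sum>x\<in>UNIV. \<Sum>t\<in>UNIV. h (x(i := t))) = CARD('a) * (\<Sum>x\<in>UNIV. h x)"
proof -
  have "(\<Sum>x\<in>UNIV. \<Sum>t\<in>UNIV. h (x(i := t))) = (\<Sum>(x, t)\<in>UNIV. h (x(i := t)))"
    by (simp add: sum.cartesian_product)
  \<comment> \<open>Exchanging \<open>t\<close> with the entry \<open>x i\<close> is an involution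
    on the pairs.\<close>
  also have "\<dots> = (\<Sum>(x, t)\<in>(UNIV :: (('i \<Rightarrow> 'a) \<times> 'a) set). h x)"
    by (rule sum.reindex_bij_witness[of _ "\<lambda>(x, t). (x(i := t), x i)" "\<lambda>(x, t). (x(i := t), x i)"]) auto
  also have "\<dots> = (\<Sum>x\<in>UNIV. \<Sum>t\<in>(UNIV :: 'a set). h x)"
    unfolding sum.cartesian_product by simp
  finally show ?thesis by (simp add: sum_distrib_left)
qed

lemma card_Collect_pos: "P t \<Longrightarrow> 0 < card {t::'b::finite. P t}"
  by (auto simp: card_gt_0_iff)

lemma card_Collect_eq_sum:
  "card {y::'b::finite. R y} = (\<Sum>y\<in>UNIV. if R y then 1 else 0)"
  by (simp add: sum.If_cases)

lemma card_fibres: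
  fixes P :: "('i::finite \<Rightarrow> 'a::finite) \<Rightarrow> bool"
  shows "(\<Sum>x\<in>UNIV. card {t. P (x(i := t))}) = CARD('a) * card {x. P x}"
  unfolding card_Collect_eq_sum by (rule sum_fibres[of "\<lambda>x. if P x then 1 else 0"])

text \<open>Take for \<open>g\<close> the coefficient of the highest power \<open>d\<close> of
  \<open>x i\<close> that occurs in \<open>f\<close>. On a line in direction \<open>i\<close> where
  \<open>g\<close> is nonzero, \<open>f\<close> restricts to a polynomial of degree \<open>d\<close>
  and has at least q - d nonzeros; summing over the lines gives the weight inequality.\<close>

lemma leading_coeff:
  fixes f :: "('i::finite \<Rightarrow> 'a::{finite,field}) \<Rightarrow> 'a"
  assumes "pdeg I D f" "f x0 \<noteq> 0"
  obtains d g where "d < CARD('a)" "d \<le> D" "pdeg (I - {i}) (D - d) g" "\<exists>x. g x \<noteq> 0"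
    "(CARD('a) - d) * wt g \<le> CARD('a) * wt f" "d = 0 \<Longrightarrow> f = g"
    "\<And>x. g x \<noteq> 0 \<Longrightarrow> \<exists>t. f (x(i := t)) \<noteq> 0"
    "\<And>x. d = CARD('a) - 1 \<Longrightarrow> card {t. f (x(i := t)) \<noteq> 0} = 1 \<Longrightarrow> g x \<noteq> 0"
proof -
  let ?q = "CARD('a)"
  obtain g where g: "\<And>e. pdeg (I - {i}) (D - e) (g e)" "\<And>e. e > D \<Longrightarrow> g e = (\<lambda>x. 0)"
    and f: "\<And>x. f x = (\<Sum>e<?q. x i ^ e * g e x)"
    using pdeg_expand[OF assms(1), of i] by blast
  define E where "E = {e. e < ?q \<and> (\<exists>x. g e x \<noteq> 0)}"
  define d where "d = Max E"
  have "finite E" unfolding E_def by simp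
  moreover have "E \<noteq> {}"
  proof
    assume "E = {}"
    then have "f x0 = 0" unfolding f E_def by (intro sum.neutral) auto
    with assms(2) show False by simp
  qed
  ultimately have "d \<in> E" and max: "\<And>e. e \<in> E \<Longrightarrow> e \<le> d" unfolding d_def by auto
  then have d: "d < ?q" and nz: "\<exists>x. g d x \<noteq> 0" unfolding E_def by auto
  have z: "g e x = 0" if "d < e" "e < ?q" for e x using max[of e] that unfolding E_def by auto
  have dD: "d \<le> D" using nz g(2)[of d] by (meson not_le_imp_less)
  have gi: "g e (x(i := t)) = g e x" for e x t by (rule pdeg_fun_upd[OF g(1)]) simp
  have fd: "f x = (\<Sum>e\<le>d. x i ^ e * g e x)" for x
    unfolding f using d z by (intro sum.mono_neutral_cong_right) auto
  have ft: "f (x(i := t)) = (\<Sum>e\<le>d. t ^ e * g e x)" for x t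
    unfolding fd gi by simp
  have nonroots: "?q - d \<le> card {t. f (x(i := t)) \<noteq> 0}" if "g d x \<noteq> 0" for x
    unfolding ft using that by (rule card_nonroots_ge) simp
  have "(?q - d) * wt (g d) = (\<Sum>x | g d x \<noteq> 0. ?q - d)" by simp
  also have "\<dots> \<le> (\<Sum>x | g d x \<noteq> 0. card {t. f (x(i := t)) \<noteq> 0})"
    using nonroots by (intro sum_mono) auto
  also have "\<dots> \<le> (\<Sum>x\<in>UNIV. card {t. f (x(i := t)) \<noteq> 0})"
    by (rule sum_mono2) auto
  also have "\<dots> = ?q * wt f" by (rule card_fibres)
  finally have lead: "(?q - d) * wt (g d) \<le> ?q * wt f" .
  show ?thesis
  proof (rule that[OF d dD g(1) nz lead])
    show "f = g d" if "d = 0" using fd that by (auto simp: fun_eq_iff)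
    show "\<exists>t. f (x(i := t)) \<noteq> 0" if "g d x \<noteq> 0" for x
    proof (rule ccontr)
      assume "\<not> ?thesis"
      then have "{t. f (x(i := t)) \<noteq> 0} = {}" by blast
      then have "card {t. f (x(i := t)) \<noteq> 0} = 0" by (metis card.empty)
      with nonroots[OF that] d show False by linarith
    qed
    show "g d x \<noteq> 0" if dq: "d = ?q - 1" and one: "card {t. f (x(i := t)) \<noteq> 0} = 1" for x
    proof
      assume gd: "g d x = 0"
      have "\<exists>k\<le>d. g k x \<noteq> 0"
      proof (rule ccontr)
        assume "\<not> ?thesis"
        then have "f (x(i := t)) = 0" for t unfolding ft by (intro sum.neutral) auto
        then have "{t. f (x(i := t)) \<noteq> 0} = {}" by blast
        then show False using one by (metis card.empty zero_neq_one)
      qed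
      then obtain k where k: "k < d" "g k x \<noteq> 0" using gd by (metis le_neq_implies_less)
      then obtain d' where d': "d = Suc d'" by (cases d) auto
      \<comment> \<open>If the coefficient of degree q - 1 vanishes at \<open>x\<close>, the line
        carries a nonzero polynomial of degree at most q - 2, hence at least two nonzeros.\<close>
      have "f (x(i := t)) = (\<Sum>e\<le>d'. t ^ e * g e x)" for t
        unfolding ft d' using gd d' by simp
      then have "?q - d' \<le> card {t. f (x(i := t)) \<noteq> 0}"
        using card_nonroots_ge[of "\<lambda>e. g e x" k d'] k d' by simp
      with one dq d' d show False by linarith
    qed
  qed
qed

text \<open>The minimum distance of generalized Reed-Muller codes.\<close>

lemma wt_min:
  fixes f :: "('i::finite \<Rightarrow> 'a::{finite,field}) \<Rightarrow> 'a"
  assumes "pdeg I (a * (CARD('a) - 1) + b) f" "b < CARD('a)" "f x0 \<noteq> 0"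
  shows "(CARD('a) - b) * CARD('a) ^ CARD('i) \<le> CARD('a) ^ (a + 1) * wt f"
proof -
  let ?q = "CARD('a)" and ?Q = "CARD('a) ^ CARD('i)"
  have "finite I" by simp
  \<comment> \<open>The induction shrinks \<open>I\<close> but not the ambient space, so
    \<open>f\<close> and its leading coefficient are weighed in the same space.\<close>
  then show ?thesis using assms
  proof (induction I arbitrary: a b f x0 rule: finite_induct)
    case empty
    have "f x = f x0" for x using empty(1) by (rule pdeg_cong) simp
    then have "{x. f x \<noteq> 0} = UNIV" using empty(3) by (metis (mono_tags, lifting) UNIV_eq_I mem_Collect_eq)
    then have "wt f = ?Q" by (simp add: card_fun)
    moreover have "?q - b \<le> ?q ^ (a + 1)"
      using self_le_power[of ?q "a + 1"] card_field_ge_2[where 'a='a] by linarith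
    ultimately show ?case by simp
  next
    case (insert i I)
    let ?D = "a * (?q - 1) + b"
    obtain d and g :: "('i \<Rightarrow> 'a) \<Rightarrow> 'a" where d: "d < ?q" "d \<le> ?D" and g: "pdeg I (?D - d) g" and nz: "\<exists>x. g x \<noteq> 0"
      and lead: "(?q - d) * wt g \<le> ?q * wt f"
      by (rule leading_coeff[OF insert.prems(1,3), of i, unfolded Diff_insert_absorb[OF insert.hyps(2)]]) (rule that, assumption+)
    from nz obtain x1 where x1: "g x1 \<noteq> 0" ..
    show ?case
    proof (cases "d \<le> b")
      case True
      have "(?q - (b - d)) * ?Q \<le> ?q ^ (a + 1) * wt g"
        using insert.IH[of a "b - d" g x1] x1 g True insert.prems(2) by simp
      then have "(?q - d) * ((?q - (b - d)) * ?Q) \<le> (?q - d) * (?q ^ (a + 1) * wt g)"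
        by (rule mult_le_mono2)
      also have "\<dots> = ?q ^ (a + 1) * ((?q - d) * wt g)" by simp
      also have "\<dots> \<le> ?q ^ (a + 1) * (?q * wt f)" by (rule mult_le_mono2[OF lead])
      finally have *: "((?q - d) * (?q - (b - d))) * ?Q \<le> ?q * (?q ^ (a + 1) * wt f)"
        by (simp add: mult_ac)
      obtain r s where rs: "b = d + r" "?q = d + r + s"
        using True insert.prems(2) by (metis le_Suc_ex less_imp_le)
      \<comment> \<open>The right side exceeds the left by d (b - d).\<close>
      have "?q * (?q - b) \<le> (?q - d) * (?q - (b - d))"
        unfolding rs by (simp add: algebra_simps)
      then have "?q * (?q - b) * ?Q \<le> (?q - d) * (?q - (b - d)) * ?Q" by (rule mult_le_mono1)
      with * have "?q * ((?q - b) * ?Q) \<le> ?q * (?q ^ (a + 1) * wt f)"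
        by (simp only: mult.assoc)
      then show ?thesis by simp
    next
      case False
      then obtain a' where a: "a = Suc a'" using d(2) by (cases a) auto
      \<comment> \<open>For d > b, subtracting d borrows one block of q - 1 from the multiple
        \<open>a\<close>.\<close>
      have eq: "?D - d = a' * (?q - 1) + (?q - 1 + b - d)"
        using d False unfolding a by simp
      have "(?q - (?q - 1 + b - d)) * ?Q \<le> ?q ^ a * wt g"
      proof -
        have "?q - 1 + b - d < ?q" using False d(1) by linarith
        from insert.IH[OF g[unfolded eq] this x1] show ?thesis unfolding a by simp
      qed
      then have "(?q - d) * ((?q - (?q - 1 + b - d)) * ?Q) \<le> (?q - d) * (?q ^ a * wt g)"
        by (rule mult_le_mono2)
      also have "\<dots> = ?q ^ a * ((?q - d) * wt g)" by simp
      also have "\<dots> \<le> ?q ^ a * (?q * wt f)" by (rule mult_le_mono2[OF lead])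
      finally have *: "((?q - d) * (?q - (?q - 1 + b - d))) * ?Q \<le> ?q ^ (a + 1) * wt f"
        by (simp add: mult_ac)
      obtain r where r: "d = b + Suc r"
        using False by (metis less_imp_Suc_add not_le_imp_less add_Suc_right)
      obtain s where s: "?q = d + Suc s"
        using d(1) by (metis less_imp_Suc_add add_Suc_right)
      \<comment> \<open>The right side exceeds the left by (q - d - 1) (d - b).\<close>
      have "?q - b \<le> (?q - d) * (?q - (?q - 1 + b - d))"
        unfolding s r by (simp add: algebra_simps)
      then have "(?q - b) * ?Q \<le> (?q - d) * (?q - (?q - 1 + b - d)) * ?Q" by (rule mult_le_mono1)
      with * show ?thesis by linarith
    qed
  qed
qed

section \<open>The gap above the minimum weight\<close>

text \<open>The normal vector is supported on \<open>I\<close> so that, once the variable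
  \<open>i\<close> is eliminated, the hyperplane found for a leading coefficient is parallel to
  direction \<open>i\<close>.\<close>

definition in_hyperplane :: "'i::finite set \<Rightarrow> (('i \<Rightarrow> 'a::field) \<Rightarrow> 'a) \<Rightarrow> bool" where
  "in_hyperplane I f \<longleftrightarrow> (\<exists>c b. (\<forall>j. j \<notin> I \<longrightarrow> c j = 0) \<and> (\<exists>j. c j \<noteq> 0) \<and>
     (\<forall>x. f x \<noteq> 0 \<longrightarrow> (\<Sum>j\<in>UNIV. c j * x j) = b))"

lemma in_hyperplane_mono: "in_hyperplane I f \<Longrightarrow> I \<subseteq> J \<Longrightarrow> in_hyperplane J f"
  unfolding in_hyperplane_def by (meson subsetD)

lemma sum_fun_upd:
  fixes c x :: "'i::finite \<Rightarrow> 'a::comm_ring"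
  shows "(\<Sum>k\<in>UNIV. c k * (x(j := t)) k) = (\<Sum>k\<in>UNIV. c k * x k) + c j * (t - x j)"
proof -
  have "(\<Sum>k\<in>UNIV. c k * y k) = c j * y j + (\<Sum>k\<in>UNIV - {j}. c k * y k)" for y :: "'i \<Rightarrow> 'a"
    by (simp add: sum.remove)
  from this[of x] this[of "x(j := t)"] show ?thesis
    by (simp add: algebra_simps)
qed

text \<open>Jamison's bound for affine blocking sets: with the origin moved to a point of \<open>A\<close>, the polynomial
  \<open>g\<close> below vanishes everywhere except at 0, which is impossible in degree less than \<open>2 (q - 1)\<close>.\<close>

lemma blocking_set_card:
  fixes A :: "('a::{finite,field} \<times> 'a) set"
  assumes "\<And>u v w. u \<noteq> 0 \<or> v \<noteq> 0 \<Longrightarrow> \<exists>s t. (s, t) \<in> A \<and> u * s + v * t = w"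
  shows "2 * CARD('a) - 1 \<le> card A"
proof (rule ccontr)
  let ?q = "CARD('a)"
  assume "\<not> ?thesis"
  then have small: "card A < 2 * ?q - 1" by simp
  obtain s0 t0 where st: "(s0, t0) \<in> A" using assms[of 1 0 0] by auto
  define l where "l z b = (if b then fst z - s0 else snd z - t0)" for z :: "'a \<times> 'a" and b
  \<comment> \<open>The factor of \<open>z\<close> vanishes at \<open>x\<close> if \<open>z\<close>
    lies on the line with normal \<open>x\<close> at offset 1 from \<open>(s0, t0)\<close>. This
    line avoids \<open>(s0, t0)\<close>, so some other point of \<open>A\<close> lies on it.\<close>
  define g where "g x = (\<Prod>z\<in>A - {(s0, t0)}. - 1 + (\<Sum>b\<in>UNIV. l z b * x b))" for x :: "bool \<Rightarrow> 'a"
  have "pdeg UNIV (card (A - {(s0, t0)}) * Suc 0) g"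
    unfolding g_def by (intro pdeg_prod pdeg_affine) simp
  moreover have "card (A - {(s0, t0)}) * Suc 0 \<le> 1 * (?q - 1) + (?q - 2)"
    using small st card_field_ge_2[where 'a='a] by (simp add: card_Diff_singleton)
  ultimately have deg: "pdeg UNIV (1 * (?q - 1) + (?q - 2)) g" by (rule pdeg_mono) simp
  have "g (\<lambda>_. 0) \<noteq> 0" unfolding g_def by simp
  \<comment> \<open>In the plane, degree (q - 1) + (q - 2) forces at least two nonzeros.\<close>
  with wt_min[OF deg, of "\<lambda>_. 0"] have "(?q - (?q - 2)) * ?q ^ CARD(bool) \<le> ?q ^ (1 + 1) * wt g"
    using card_field_ge_2[where 'a='a] by simp
  moreover have "?q - (?q - 2) = 2" using card_field_ge_2[where 'a='a] by simp
  ultimately have "2 \<le> wt g" by (simp add: power2_eq_square)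
  have "g x = 0" if "x \<noteq> (\<lambda>_. 0)" for x
  proof -
    have "x True \<noteq> 0 \<or> x False \<noteq> 0" using that by (metis (full_types) ext)
    then obtain s t where z: "(s, t) \<in> A" "x True * s + x False * t = x True * s0 + x False * t0 + 1"
      using assms by blast
    then have "(s, t) \<noteq> (s0, t0)" by auto
    moreover have "- 1 + (\<Sum>b\<in>UNIV. l (s, t) b * x b) = 0"
      using z(2) by (simp add: UNIV_bool l_def algebra_simps)
    ultimately show ?thesis unfolding g_def using z(1) by (intro prod_zero) auto
  qed
  then have "{x. g x \<noteq> 0} \<subseteq> {\<lambda>_. 0}" by blast
  then have "wt g \<le> card {\<lambda>_::bool. 0::'a}" by (rule card_mono[rotated]) simp
  with \<open>2 \<le> wt g\<close> show False by simp
qed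

text \<open>If the highest power \<open>d\<close> lies strictly between 0 and q - 1, the minimum
  distance of its coefficient makes \<open>CARD('a) ^ (a + 2) * wt f\<close> at least (q - d)(d + 1)
  q^N. This contradicts the weight bound, since (q - d)(d + 1) - 2 (q - 1) = (d - 1)(q - 2 - d) is
  nonnegative. So either \<open>f\<close> is independent of \<open>x i\<close> or the power q - 1
  occurs.\<close>

lemma top_coeff_cases:
  fixes f :: "('i::finite \<Rightarrow> 'a::{finite,field}) \<Rightarrow> 'a"
  assumes f: "pdeg I (Suc a * (CARD('a) - 1)) f" "f x0 \<noteq> 0"
    and small: "CARD('a) ^ (a + 2) * wt f < 2 * (CARD('a) - 1) * CARD('a) ^ CARD('i)"
  obtains (indep) "pdeg (I - {i}) (Suc a * (CARD('a) - 1)) f"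
  | (top) g where "pdeg (I - {i}) (a * (CARD('a) - 1)) g" "\<exists>x. g x \<noteq> 0" "wt g \<le> CARD('a) * wt f"
    "\<And>x. g x \<noteq> 0 \<Longrightarrow> \<exists>t. f (x(i := t)) \<noteq> 0"
    "\<And>x. card {t. f (x(i := t)) \<noteq> 0} = 1 \<Longrightarrow> g x \<noteq> 0"
proof -
  let ?q = "CARD('a)" and ?Q = "CARD('a) ^ CARD('i)"
  obtain d g where d: "d < ?q" and g: "pdeg (I - {i}) (Suc a * (?q - 1) - d) g" and nz: "\<exists>x. g x \<noteq> 0"
    and lead: "(?q - d) * wt g \<le> ?q * wt f" and z: "d = 0 \<Longrightarrow> f = g"
    and ex: "\<And>x. g x \<noteq> 0 \<Longrightarrow> \<exists>t. f (x(i := t)) \<noteq> 0"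
    and one: "\<And>x. d = ?q - 1 \<Longrightarrow> card {t. f (x(i := t)) \<noteq> 0} = 1 \<Longrightarrow> g x \<noteq> 0"
    by (rule leading_coeff[OF f, of i]) (rule that)
  consider "d = 0" | "d = ?q - 1" | "1 \<le> d" "d \<le> ?q - 2" using d by linarith
  then show ?thesis
  proof cases
    case 1
    with g z show ?thesis by (intro indep) simp
  next
    case 2
    then have "wt g \<le> ?q * wt f" using lead d by simp
    moreover have "pdeg (I - {i}) (a * (?q - 1)) g" using g 2 by simp
    ultimately show ?thesis using nz ex one 2 by (intro top)
  next
    case 3
    obtain x1 where x1: "g x1 \<noteq> 0" using nz by blast
    have "Suc a * (?q - 1) - d = a * (?q - 1) + (?q - 1 - d)" using 3 by simp
    then have "(?q - (?q - 1 - d)) * ?Q \<le> ?q ^ (a + 1) * wt g"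
      using wt_min[of "I - {i}" a "?q - 1 - d" g x1] x1 g d by simp
    then have "(d + 1) * ?Q \<le> ?q ^ (a + 1) * wt g" using d by (simp add: Suc_diff_Suc)
    then have "(?q - d) * ((d + 1) * ?Q) \<le> (?q - d) * (?q ^ (a + 1) * wt g)"
      by (rule mult_le_mono2)
    also have "\<dots> = ?q ^ (a + 1) * ((?q - d) * wt g)" by simp
    also have "\<dots> \<le> ?q ^ (a + 1) * (?q * wt f)" by (rule mult_le_mono2[OF lead])
    also have "\<dots> = ?q ^ (a + 2) * wt f" by simp
    also have "\<dots> < 2 * (?q - 1) * ?Q" by (rule small)
    finally have "((?q - d) * (d + 1)) * ?Q < 2 * (?q - 1) * ?Q" by (simp only: mult.assoc)
    then have "(?q - d) * (d + 1) < 2 * (?q - 1)" by simp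
    moreover obtain r where r: "d = Suc r" using 3 by (cases d) auto
    moreover obtain s where s: "?q = d + 2 + s" using 3 by (metis add.commute le_Suc_ex le_diff_conv2 card_field_ge_2)
    ultimately show ?thesis by (simp add: algebra_simps)
  qed
qed

text \<open>The weight is counted in the whole space, also for functions that only depend on the
  coordinates in \<open>I\<close>; so the bounds depend on the codimension \<open>a\<close> but not on \<open>I\<close>.\<close>

lemma second_weight:
  fixes f :: "('i::finite \<Rightarrow> 'a::{finite,field}) \<Rightarrow> 'a"
  assumes "pdeg I (a * (CARD('a) - 1)) f" "f x0 \<noteq> 0"
    and "CARD('a) ^ (a + 1) * wt f < 2 * (CARD('a) - 1) * CARD('a) ^ CARD('i)"
  shows "CARD('a) ^ a * wt f = CARD('a) ^ CARD('i) \<and> (0 < a \<longrightarrow> in_hyperplane I f)"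
  using assms
proof (induction "card I" arbitrary: I a f x0 rule: less_induct)
  case less
  let ?q = "CARD('a)" and ?Q = "CARD('a) ^ CARD('i)"
  have q2: "2 \<le> ?q" by (rule card_field_ge_2)
  have IH: "?q ^ b * wt h = ?Q \<and> (0 < b \<longrightarrow> in_hyperplane (I - {i}) h)"
    if "i \<in> I" "pdeg (I - {i}) (b * (?q - 1)) h" "\<exists>x. h x \<noteq> 0"
      "?q ^ (b + 1) * wt h < 2 * (?q - 1) * ?Q" for i b and h :: "('i \<Rightarrow> 'a) \<Rightarrow> 'a"
  proof -
    have "card (I - {i}) < card I" using that(1) by (meson card_Diff1_less finite)
    with less.hyps that show ?thesis by blast
  qed
  have const: "wt f = ?Q" if "\<And>x. f x = f x0"
  proof -
    have "{x. f x \<noteq> 0} = UNIV" using less.prems(2) that by (metis (mono_tags, lifting) UNIV_eq_I mem_Collect_eq)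
    then show ?thesis by (simp add: card_fun)
  qed
  show ?case
  proof (cases a)
    case 0
    have "f x = f x0" for x using less.prems(1) 0 by (intro pdeg_0_const) auto
    then show ?thesis using const 0 by simp
  next
    case (Suc a')
    have IHindep: "?q ^ a * wt h = ?Q \<and> in_hyperplane I h"
      if "i \<in> I" "pdeg (I - {i}) (Suc a' * (?q - 1)) h" "\<exists>x. h x \<noteq> 0" "wt h = wt f" for i and h :: "('i \<Rightarrow> 'a) \<Rightarrow> 'a"
      using IH[OF that(1) _ that(3), of a] that(2,4) less.prems(3) in_hyperplane_mono[of "I - {i}" h I]
      unfolding Suc by auto
    have f: "pdeg I (Suc a' * (?q - 1)) f" "?q ^ (a' + 2) * wt f < 2 * (?q - 1) * ?Q"
      using less.prems Suc by simp_all
    \<comment> \<open>The coefficient of the power q - 1 has up to q times the weight of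
      \<open>f\<close>, but the threshold for \<open>a'\<close> is also q times larger, so the
      induction hypothesis applies.\<close>
    have IHtop: "?q ^ a' * wt g = ?Q \<and> (0 < a' \<longrightarrow> in_hyperplane (I - {i}) g)"
      if "i \<in> I" "pdeg (I - {i}) (a' * (?q - 1)) g" "\<exists>x. g x \<noteq> 0" "wt g \<le> ?q * wt f" for i and g :: "('i \<Rightarrow> 'a) \<Rightarrow> 'a"
    proof -
      have "?q ^ (a' + 1) * wt g \<le> ?q ^ (a' + 1) * (?q * wt f)" using that(4) by (rule mult_le_mono2)
      also have "\<dots> = ?q ^ (a' + 2) * wt f" by simp
      also note f(2)
      finally show ?thesis using IH[OF that(1-3)] by blast
    qed
    have "I \<noteq> {}"
    proof
      assume "I = {}"
      have "f x = f x0" for x by (rule pdeg_cong[OF f(1)]) (simp add: \<open>I = {}\<close>)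
      then have "wt f = ?Q" by (rule const)
      then have "?q ^ (a' + 2) < 2 * (?q - 1)" using f(2) by simp
      moreover have "?q * 2 \<le> ?q * ?q" using q2 by simp
      moreover have "?q * ?q \<le> ?q ^ (a' + 2)" using q2 by simp
      ultimately show False by linarith
    qed
    then obtain i where i: "i \<in> I" by blast
    show ?thesis
    proof (cases rule: top_coeff_cases[OF f(1) less.prems(2) f(2), where i = i])
      case 1
      then show ?thesis using IHindep[OF i] less.prems(2) by blast
    next
      case g: (2 g)
      note gw = IHtop[OF i g(1-3)]
      show ?thesis
      proof (cases "a' = 0")
        case False
        then obtain c b where c: "\<And>j. j \<notin> I - {i} \<Longrightarrow> c j = 0" "\<exists>j. c j \<noteq> 0"
          and cg: "\<And>x. g x \<noteq> 0 \<Longrightarrow> (\<Sum>j\<in>UNIV. c j * x j) = b"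
          using gw False unfolding in_hyperplane_def by blast
        \<comment> \<open>The support of \<open>g\<close> lies in the hyperplane
          \<open>l = 0\<close>, which is parallel to direction \<open>i\<close> because
          \<open>c i = 0\<close>.\<close>
        define l where "l x = - b + (\<Sum>j\<in>UNIV. c j * x j)" for x :: "'i \<Rightarrow> 'a"
        have lupd: "l (x(j := t)) = l x + c j * (t - x j)" for x j t
          unfolding l_def sum_fun_upd by simp
        have ci: "c i = 0" using c(1) by simp
        have split: "wt f = wt (\<lambda>x. f x * l x) + card {x. f x \<noteq> 0 \<and> l x = 0}"
        proof -
          have "{x. f x \<noteq> 0} = {x. f x * l x \<noteq> 0} \<union> {x. f x \<noteq> 0 \<and> l x = 0}" by auto
          moreover have "{x. f x * l x \<noteq> 0} \<inter> {x. f x \<noteq> 0 \<and> l x = 0} = {}" by auto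
          ultimately show ?thesis by (simp add: card_Un_disjoint)
        qed
        \<comment> \<open>A line in direction \<open>i\<close> through a point of the support of
          \<open>g\<close> stays in the hyperplane and meets the support of \<open>f\<close>. Hence
          the hyperplane holds at least q^(N-a) points of the support of \<open>f\<close>.\<close>
        have "wt g = (\<Sum>x | g x \<noteq> 0. 1)" by simp
        also have "\<dots> \<le> (\<Sum>x | g x \<noteq> 0. card {t. f (x(i := t)) \<noteq> 0 \<and> l (x(i := t)) = 0})"
        proof (rule sum_mono)
          fix x assume "x \<in> {x. g x \<noteq> 0}"
          then have gx: "g x \<noteq> 0" by simp
          then obtain t where "f (x(i := t)) \<noteq> 0" using g(4) by blast
          moreover have "l (x(i := t)) = 0" using cg[OF gx] unfolding lupd ci by (simp add: l_def)
          ultimately have "0 < card {t. f (x(i := t)) \<noteq> 0 \<and> l (x(i := t)) = 0}"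
            by (intro card_Collect_pos) (rule conjI)
          then show "1 \<le> card {t. f (x(i := t)) \<noteq> 0 \<and> l (x(i := t)) = 0}" by linarith
        qed
        also have "\<dots> \<le> (\<Sum>x\<in>UNIV. card {t. f (x(i := t)) \<noteq> 0 \<and> l (x(i := t)) = 0})"
          by (rule sum_mono2) auto
        also have "\<dots> = ?q * card {x. f x \<noteq> 0 \<and> l x = 0}"
          by (rule card_fibres[of "\<lambda>x. f x \<noteq> 0 \<and> l x = 0"])
        finally have "?q ^ Suc a' * wt g \<le> ?q ^ Suc a' * (?q * card {x. f x \<noteq> 0 \<and> l x = 0})"
          by (rule mult_le_mono2)
        moreover have "?q ^ Suc a' * wt g = ?q * ?Q" using gw by simp
        moreover have "?q ^ Suc a' * (?q * card {x. f x \<noteq> 0 \<and> l x = 0}) =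
            ?q ^ (a' + 2) * card {x. f x \<noteq> 0 \<and> l x = 0}" by simp
        ultimately have inH: "?q * ?Q \<le> ?q ^ (a' + 2) * card {x. f x \<noteq> 0 \<and> l x = 0}"
          by linarith
        \<comment> \<open>Outside the hyperplane the support of \<open>f\<close> is that of
          \<open>f x * l x\<close>, of degree a(q - 1) + 1. If nonempty it adds (q - 1) q^(N-a-1)
          points, and the total reaches (2q - 1) q^(N-a-1), beyond the assumed bound.\<close>
        have fl: "f x * l x = 0" for x
        proof (rule ccontr)
          assume nz: "f x * l x \<noteq> 0"
          have "pdeg I (Suc 0) l" unfolding l_def using c(1) by (intro pdeg_affine) auto
          from pdeg_mult[OF f(1) this]
          have "pdeg I (Suc a' * (?q - 1) + 1) (\<lambda>x. f x * l x)" unfolding One_nat_def .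
          moreover have "1 < ?q" using q2 by linarith
          ultimately have "(?q - 1) * ?Q \<le> ?q ^ (Suc a' + 1) * wt (\<lambda>x. f x * l x)"
            using nz by (rule wt_min[of I "Suc a'" 1 "\<lambda>x. f x * l x" x])
          moreover have "Suc a' + 1 = a' + 2" by simp
          ultimately have "(?q - 1) * ?Q \<le> ?q ^ (a' + 2) * wt (\<lambda>x. f x * l x)" by (simp only:)
          with inH have "?q * ?Q + (?q - 1) * ?Q \<le> ?q ^ (a' + 2) * wt f"
            unfolding split distrib_left by linarith
          also note f(2)
          finally have "(?q + (?q - 1)) * ?Q < (2 * (?q - 1)) * ?Q" by (simp only: distrib_right)
          then have "?q + (?q - 1) < 2 * (?q - 1)" by simp
          then show False by simp
        qed
        have hyp: "in_hyperplane I f" unfolding in_hyperplane_def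
        proof (intro exI[of _ c] exI[of _ b] conjI allI impI)
          show "c j = 0" if "j \<notin> I" for j using c(1) that by blast
          show "\<exists>j. c j \<noteq> 0" by (rule c(2))
          show "(\<Sum>j\<in>UNIV. c j * x j) = b" if "f x \<noteq> 0" for x
            using fl[of x] that by (simp add: l_def)
        qed
        \<comment> \<open>For the exact weight, use a direction transversal to the hyperplane: each
          line then holds at most one point of the support, and the leading coefficient
          \<open>h\<close> marks exactly the lines that hold one. So q times the weight of
          \<open>f\<close> is the weight of \<open>h\<close>.\<close>
        obtain j where cj: "c j \<noteq> 0" using c(2) by blast
        then have j: "j \<in> I" using c(1) by blast
        show ?thesis
        proof (cases rule: top_coeff_cases[OF f(1) less.prems(2) f(2), where i = j])
          case 1
          then show ?thesis using IHindep[OF j] less.prems(2) by blast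
        next
          case h: (2 h)
          have fib: "card {t. f (x(j := t)) \<noteq> 0} = (if h x \<noteq> 0 then 1 else 0)" for x
          proof -
            have "t = x j - l x / c j" if "f (x(j := t)) \<noteq> 0" for t
            proof -
              have "l x + c j * (t - x j) = 0" using fl[of "x(j := t)"] that unfolding lupd by simp
              then show ?thesis using cj by (simp add: field_simps)
            qed
            then have "{t. f (x(j := t)) \<noteq> 0} \<subseteq> {x j - l x / c j}" by blast
            then have "card {t. f (x(j := t)) \<noteq> 0} \<le> card {x j - l x / c j}" by (rule card_mono[rotated]) simp
            then have le1: "card {t. f (x(j := t)) \<noteq> 0} \<le> 1" by simp
            show ?thesis
            proof (cases "h x = 0")
              case True
              then have "card {t. f (x(j := t)) \<noteq> 0} \<noteq> 1" using h(5)[of x] by blast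
              with le1 have "card {t. f (x(j := t)) \<noteq> 0} = 0" by linarith
              then show ?thesis using True by simp
            next
              case hx: False
              with h(4) obtain t where "f (x(j := t)) \<noteq> 0" by blast
              then have "0 < card {t. f (x(j := t)) \<noteq> 0}" by (rule card_Collect_pos)
              with le1 have "card {t. f (x(j := t)) \<noteq> 0} = 1" by linarith
              then show ?thesis using hx by simp
            qed
          qed
          have "?q * wt f = (\<Sum>x\<in>UNIV. card {t. f (x(j := t)) \<noteq> 0})"
            by (rule card_fibres[symmetric])
          also have "\<dots> = wt h" unfolding fib by (rule card_Collect_eq_sum[symmetric])
          finally have "?q ^ a' * (?q * wt f) = ?Q" using IHtop[OF j h(1-3)] by (simp only:)
          then have "?q ^ a * wt f = ?Q" unfolding Suc by (simp only: power_Suc mult_ac)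
          then show ?thesis using hyp by blast
        qed
      next
        case a0: True
        then have qq: "?q ^ (a' + 2) * wt f = ?q * (?q * wt f)" by (simp add: power2_eq_square)
        show ?thesis
        proof (cases "I = {i}")
          case True
          \<comment> \<open>With a single variable every line in direction \<open>i\<close> carries
            the same \<open>m\<close> nonzeros, and the weight bound leaves only
            \<open>m = 1\<close>.\<close>
          define m where "m = card {t. f (x0(i := t)) \<noteq> 0}"
          have f0: "f (x(i := t)) = f (x0(i := t))" for x t
            by (rule pdeg_cong[OF f(1)]) (simp add: True)
          have "card {t. f (x(i := t)) \<noteq> 0} = m" for x unfolding m_def by (simp only: f0[of x])
          then have wtf: "?q * wt f = m * ?Q"
            unfolding card_fibres[of "\<lambda>x. f x \<noteq> 0" i, symmetric] by (simp add: card_fun)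
          have "?q * (m * ?Q) < 2 * (?q - 1) * ?Q" using f(2) unfolding qq wtf .
          then have "?q * m * ?Q < 2 * (?q - 1) * ?Q" by (simp only: mult.assoc)
          then have "?q * m < 2 * (?q - 1)" by simp
          also have "\<dots> < ?q * 2" using q2 by simp
          finally have "m < 2" by simp
          have "f (x0(i := x0 i)) \<noteq> 0" using less.prems(2) by simp
          then have "0 < m" unfolding m_def by (rule card_Collect_pos)
          with \<open>m < 2\<close> have "m = 1" by simp
          then obtain t0 where t0: "{t. f (x0(i := t)) \<noteq> 0} = {t0}"
            unfolding m_def by (metis card_1_singletonE)
          have "in_hyperplane I f" unfolding in_hyperplane_def
          proof (intro exI[of _ "\<lambda>k. if k = i then 1 else 0"] exI[of _ t0] conjI allI impI)
            show "(\<Sum>k\<in>UNIV. (if k = i then 1 else 0) * x k) = t0" if "f x \<noteq> 0" for x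
            proof -
              have "f (x0(i := x i)) = f x" by (rule pdeg_cong[OF f(1)]) (simp add: True)
              then have "f (x0(i := x i)) \<noteq> 0" using that by metis
              then have "x i \<in> {t. f (x0(i := t)) \<noteq> 0}" by (rule CollectI)
              then have "x i = t0" unfolding t0 by (rule singletonD)
              moreover have "(\<Sum>k\<in>UNIV. (if k = i then 1 else 0) * x k) =
                  (\<Sum>k\<in>UNIV. if k = i then x k else 0)"
                by (rule sum.cong) simp_all
              ultimately show ?thesis by simp
            qed
          qed (use i in auto)
          then show ?thesis using wtf \<open>m = 1\<close> Suc a0 by simp
        next
          case False
          then obtain j where j: "j \<in> I" "j \<noteq> i" using i by blast
          \<comment> \<open>The shear turns lines of slope \<open>c\<close> in the plane of
            \<open>i\<close> and \<open>j\<close> into lines in direction \<open>i\<close>.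
            Independence of \<open>F c\<close> from \<open>x i\<close> means that \<open>f\<close>
            is constant along slope \<open>c\<close>.\<close>
          define F where "F c x = f (x(j := x j + c * x i))" for c x
          have degF: "pdeg I (Suc a' * (?q - 1)) (F c)" for c
            unfolding F_def by (rule pdeg_shear[OF f(1) i])
          have Finv: "F c (x(j := x j - c * x i)) = f x" for c x
            unfolding F_def using j(2) by simp
          have wtF: "wt (F c) = wt f" for c
            by (rule bij_betw_same_card[of "\<lambda>x. x(j := x j + c * x i)"],
                rule bij_betw_byWitness[where f' = "\<lambda>x. x(j := x j - c * x i)"])
               (use j(2) in \<open>auto simp: F_def\<close>)
          have nzF: "F c (x0(j := x0 j - c * x0 i)) \<noteq> 0" for c using Finv less.prems(2) by simp
          show ?thesis
          proof (cases "\<exists>c. pdeg (I - {i}) (Suc a' * (?q - 1)) (F c)")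
            case True
            then obtain u where u: "pdeg (I - {i}) (Suc a' * (?q - 1)) (F u)" ..
            have R: "?q ^ a * wt (F u) = ?Q \<and> in_hyperplane I (F u)"
              using IHindep[OF i u exI[where P = "\<lambda>x. F u x \<noteq> 0", OF nzF] wtF] .
            then obtain c b where c: "\<And>k. k \<notin> I \<Longrightarrow> c k = 0" "\<exists>k. c k \<noteq> 0"
              and cF: "\<And>x. F u x \<noteq> 0 \<Longrightarrow> (\<Sum>k\<in>UNIV. c k * x k) = b"
              unfolding in_hyperplane_def by blast
            \<comment> \<open>Undoing the shear replaces \<open>x j\<close> by
              \<open>x j - u * x i\<close> in the equation, which changes only the coefficient of
              \<open>x i\<close>.\<close>
            have "in_hyperplane I f" unfolding in_hyperplane_def
            proof (intro exI[of _ "c(i := c i - c j * u)"] exI[of _ b] conjI allI impI)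
              show "(c(i := c i - c j * u)) k = 0" if "k \<notin> I" for k using that i c(1) by auto
              show "\<exists>k. (c(i := c i - c j * u)) k \<noteq> 0"
              proof (cases "c j = 0")
                case True
                with c(2) show ?thesis by auto
              next
                case False
                with j(2) show ?thesis by (intro exI[of _ j]) simp
              qed
              show "(\<Sum>k\<in>UNIV. (c(i := c i - c j * u)) k * x k) = b" if "f x \<noteq> 0" for x
              proof -
                have "(\<Sum>k\<in>UNIV. c k * (x(j := x j - u * x i)) k) = b"
                  using that by (intro cF) (simp only: Finv not_False_eq_True)
                moreover have "(\<Sum>k\<in>UNIV. x k * (c(i := c i - c j * u)) k) =
                    (\<Sum>k\<in>UNIV. c k * (x(j := x j - u * x i)) k)"
                  unfolding sum_fun_upd by (simp add: algebra_simps)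
                ultimately show ?thesis by (simp add: mult.commute)
              qed
            qed
            then show ?thesis using R wtF by simp
          next
            case noF: False
            show ?thesis
            proof (cases "pdeg (I - {j}) (Suc a' * (?q - 1)) f")
              case True
              then show ?thesis using IHindep[OF j(1) True] less.prems(2) by blast
            next
              case nof: False
              \<comment> \<open>Here the leading coefficient has degree 0 and is a nonzero constant,
                so every line in this direction meets the support.\<close>
              have line: "\<exists>t. h (x(k := t)) \<noteq> 0"
                if "pdeg I (Suc a' * (?q - 1)) h" "h y \<noteq> 0" "wt h = wt f"
                  "\<not> pdeg (I - {k}) (Suc a' * (?q - 1)) h" for h :: "('i \<Rightarrow> 'a) \<Rightarrow> 'a" and y k x
              proof -
                have small: "?q ^ (a' + 2) * wt h < 2 * (?q - 1) * ?Q" using that(3) f(2) by simp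
                show ?thesis
                proof (cases rule: top_coeff_cases[OF that(1,2) small, where i = k])
                  case 1
                  with that(4) show ?thesis by blast
                next
                  case h: (2 g)
                  then obtain x1 where "g x1 \<noteq> 0" by blast
                  moreover have "g x = g x1" using pdeg_0_const[OF h(1), of x x1] a0 by simp
                  ultimately show ?thesis using h(4) by simp
                qed
              qed
              have plane: "2 * ?q - 1 \<le> card {(s, t). f (x(i := s, j := t)) \<noteq> 0}" for x
              proof (rule blocking_set_card)
                fix u v w :: 'a assume uv: "u \<noteq> 0 \<or> v \<noteq> 0"
                show "\<exists>s t. (s, t) \<in> {(s, t). f (x(i := s, j := t)) \<noteq> 0} \<and> u * s + v * t = w"
                proof (cases "v = 0")
                  case True
                  obtain t where "f (x(i := w / u, j := t)) \<noteq> 0"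
                    using line[OF f(1) less.prems(2) refl nof] by blast
                  then show ?thesis using True uv by (intro exI[of _ "w / u"] exI[of _ t]) simp
                next
                  case False
                  \<comment> \<open>The line has slope \<open>- u / v\<close> and passes through
                    \<open>(0, w / v)\<close>.\<close>
                  have "\<not> pdeg (I - {i}) (Suc a' * (?q - 1)) (F (- u / v))" using noF by blast
                  from line[OF degF nzF wtF this, of "x(j := w / v)"]
                  obtain s where s: "F (- u / v) (x(j := w / v, i := s)) \<noteq> 0" by blast
                  have "x(j := w / v, i := s, j := w / v + - u / v * s) = x(i := s, j := w / v + - u / v * s)"
                    using j(2) by (auto simp: fun_eq_iff)
                  then have "f (x(i := s, j := w / v + - u / v * s)) \<noteq> 0"
                    using s j(2) unfolding F_def by simp
                  moreover have "u * s + v * (w / v + - u / v * s) = w" using False by (simp add: field_simps)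
                  ultimately show ?thesis by blast
                qed
              qed
              \<comment> \<open>Averaging over all parallel planes counts each point of the support
                q^2 times.\<close>
              have "(2 * ?q - 1) * ?Q = (\<Sum>x\<in>(UNIV :: ('i \<Rightarrow> 'a) set). 2 * ?q - 1)"
                by (simp add: card_fun)
              also have "\<dots> \<le> (\<Sum>x\<in>UNIV. card {(s, t). f (x(i := s, j := t)) \<noteq> 0})"
                by (rule sum_mono) (rule plane)
              also have "\<dots> = (\<Sum>x\<in>UNIV. \<Sum>s\<in>UNIV. card {t. f (x(i := s, j := t)) \<noteq> 0})"
              proof (rule sum.cong[OF refl])
                fix x
                have "{(s, t). f (x(i := s, j := t)) \<noteq> 0} = (SIGMA s:UNIV. {t. f (x(i := s, j := t)) \<noteq> 0})"
                  by auto
                then show "card {(s, t). f (x(i := s, j := t)) \<noteq> 0} =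
                    (\<Sum>s\<in>UNIV. card {t. f (x(i := s, j := t)) \<noteq> 0})" by simp
              qed
              also have "\<dots> = ?q * (\<Sum>x\<in>UNIV. card {t. f (x(j := t)) \<noteq> 0})"
                by (rule sum_fibres[of "\<lambda>x. card {t. f (x(j := t)) \<noteq> 0}"])
              also have "\<dots> = ?q * (?q * wt f)" by (simp only: card_fibres[of "\<lambda>x. f x \<noteq> 0"])
              also have "\<dots> = ?q ^ (a' + 2) * wt f" by (rule qq[symmetric])
              also note f(2)
              finally have "2 * ?q - 1 < 2 * (?q - 1)" by simp
              then show ?thesis by simp
            qed
          qed
        qed
      qed
    qed
  qed
qed

section \<open>From codewords to polynomial functions\<close>

text \<open>Shifting by 1 permutes the field, so the sum of its elements shows that q is 0 in it.
  Knowing the characteristic identifies the residues mod \<open>p\<close> in \<open>code\<close>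
  with field elements.\<close>

lemma CHAR_eq_prime:
  assumes "prime p" "CARD('a::{finite,field}) = p ^ h"
  shows "CHAR('a) = p"
proof -
  have "(\<Sum>x\<in>UNIV. x + 1) = (\<Sum>x\<in>UNIV. x :: 'a)"
    by (rule sum.reindex_bij_witness[of _ "\<lambda>x. x - 1" "\<lambda>x. x + 1"]) auto
  then have "of_nat CARD('a) = (0 :: 'a)" by (simp add: sum.distrib)
  then have "CHAR('a) dvd p ^ h" using assms(2) of_nat_eq_0_iff_char_dvd by metis
  moreover have "prime CHAR('a)" by (rule prime_CHAR_semidom) (simp add: finite_imp_CHAR_pos)
  ultimately show ?thesis using assms(1) by (metis prime_dvd_power primes_dvd_imp_eq)
qed

text \<open>Extend a basis of \<open>W\<close>; the added coordinates give codimension many linear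
  forms r that cut out \<open>W\<close>. The indicator is the product of the 1 - r^(q-1), each split
  into the q - 1 affine factors 1 - r/t with t nonzero.\<close>

lemma pdeg_subspace_indicator:
  fixes W :: "('a::{finite,field} ^ 'n::finite) set"
  assumes W: "vec.subspace W"
  shows "\<exists>f. pdeg UNIV ((CARD('n) - vec.dim W) * (CARD('a) - 1)) f \<and>
             (\<forall>x. f (($) x) = (if x \<in> W then 1 else 0))"
proof -
  obtain B where B: "B \<subseteq> W" "vec.independent B" "W \<subseteq> vec.span B" "card B = vec.dim W"
    by (rule vec.basis_exists)
  have spanB: "vec.span B = W" using B(1,3) W by (metis subset_antisym vec.span_minimal)
  define B' where "B' = vec.extend_basis B"
  have B': "vec.independent B'" "vec.span B' = UNIV" "B \<subseteq> B'"
    unfolding B'_def using B(2)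
    by (simp_all add: vec.independent_extend_basis vec.span_extend_basis vec.extend_basis_superset)
  have "card B' = vec.dim (UNIV :: ('a ^ 'n) set)"
    using B'(1,2) by (metis vec.dim_eq_card_independent vec.dim_span)
  then have "card B' = CARD('n)" by (simp add: vec_dim_card card_cart_basis)
  then have cardC: "card (B' - B) = CARD('n) - vec.dim W"
    using B(4) B'(3) by (simp add: card_Diff_subset)
  define r where "r = vec.representation B'"
  have r_lin: "r x b = (\<Sum>i\<in>UNIV. r (axis i 1) b * x $ i)" for x b
  proof -
    have "r x b = r (\<Sum>i\<in>UNIV. x $ i *s axis i 1) b" by (simp add: basis_expansion)
    also have "\<dots> = (\<Sum>i\<in>UNIV. r (axis i 1) b * x $ i)"
      unfolding r_def using B'(1,2)
      by (simp add: vec.representation_sum vec.representation_scale mult.commute)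
    finally show ?thesis .
  qed
  have mem: "x \<in> W \<longleftrightarrow> (\<forall>b\<in>B' - B. r x b = 0)" for x
  proof
    assume "x \<in> W"
    then have "x \<in> vec.span B" using spanB by simp
    then have "r x = vec.representation B x"
      unfolding r_def using B'(1,3) by (intro vec.representation_extend) auto
    then show "\<forall>b\<in>B' - B. r x b = 0" using vec.representation_ne_zero[of B x] by auto
  next
    assume *: "\<forall>b\<in>B' - B. r x b = 0"
    have "x = (\<Sum>b\<in>B'. r x b *s b)"
      unfolding r_def using B'(1,2) by (intro vec.sum_representation_eq[symmetric]) auto
    also have "\<dots> = (\<Sum>b\<in>B. r x b *s b)"
      using * B'(3) by (intro sum.mono_neutral_right) auto
    also have "\<dots> \<in> vec.span B" by (intro vec.span_sum vec.span_scale vec.span_base)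
    finally show "x \<in> W" using spanB by simp
  qed
  define Z where "Z = (B' - B) \<times> (UNIV - {0 :: 'a})"
  define f where "f y = (\<Prod>z\<in>Z. 1 + (\<Sum>i\<in>UNIV. (- inverse (snd z) * r (axis i 1) (fst z)) * y i))"
    for y :: "'n \<Rightarrow> 'a"
  have "card Z = (CARD('n) - vec.dim W) * (CARD('a) - 1)"
    unfolding Z_def by (simp add: card_cartesian_product cardC)
  moreover have "pdeg UNIV (card Z * Suc 0) f" unfolding f_def by (intro pdeg_prod pdeg_affine) simp
  moreover have "f (($) x) = (if x \<in> W then 1 else 0)" for x
  proof -
    have fx: "f (($) x) = (\<Prod>z\<in>Z. 1 - inverse (snd z) * r x (fst z))"
      unfolding f_def r_lin[of x] by (simp add: sum_distrib_left sum_negf mult.assoc)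
    show ?thesis
    proof (cases "x \<in> W")
      case True
      then show ?thesis unfolding fx using mem by (auto simp: Z_def intro!: prod.neutral)
    next
      case False
      then obtain b where "b \<in> B' - B" "r x b \<noteq> 0" using mem by blast
      then have "(b, r x b) \<in> Z" "1 - inverse (snd (b, r x b)) * r x (fst (b, r x b)) = 0"
        unfolding Z_def by simp_all
      then have "f (($) x) = 0" unfolding fx by (intro prod_zero) (auto intro!: bexI[of _ "(b, r x b)"])
      then show ?thesis using False by simp
    qed
  qed
  ultimately show ?thesis by auto
qed

lemma card_span_singleton:
  fixes v :: "'a::{finite,field} ^ 'n::finite"
  assumes "v \<noteq> 0"
  shows "card (vec.span {v}) = CARD('a)"
proof -
  have "vec.span {v} = range (\<lambda>t. t *s v)" by (rule vec.span_singleton)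
  moreover have "inj (\<lambda>t. t *s v)" using assms by (auto intro!: injI)
  ultimately show ?thesis by (simp add: card_image)
qed

lemma PG_point_eq_span:
  fixes v :: "'a::field ^ 'n::finite"
  assumes "P \<in> PG_points" "v \<in> P" "v \<noteq> 0"
  shows "P = vec.span {v}"
proof -
  obtain u where P: "P = vec.span {u}" using assms(1) unfolding PG_points_def by blast
  then obtain t where v: "v = t *s u" using assms(2) by (auto simp: vec.span_singleton)
  with assms(3) have "t \<noteq> 0" by auto
  then have "u = inverse t *s v" using v by (simp add: vector_smult_assoc)
  then have "u \<in> vec.span {v}" by (metis vec.span_base vec.span_scale singletonI)
  moreover have "v \<in> vec.span {u}" using assms(2) P by simp
  ultimately show ?thesis unfolding P by (intro vec.span_eq[THEN iffD2]) auto
qed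

text \<open>Distinct projective points share only the zero vector, and each contains q - 1 nonzero
  vectors.\<close>

lemma card_cone:
  fixes A :: "('a::{finite,field} ^ 'n::finite) set set"
  assumes A: "A \<subseteq> PG_points"
  shows "card {x. x \<noteq> 0 \<and> vec.span {x} \<in> A} = (CARD('a) - 1) * card A"
proof -
  have pt: "\<exists>v. v \<noteq> 0 \<and> P = vec.span {v}" if "P \<in> A" for P
    using that A unfolding PG_points_def by blast
  have "{x. x \<noteq> 0 \<and> vec.span {x} \<in> A} = (\<Union>P\<in>A. P - {0})"
  proof (intro set_eqI iffI)
    fix x assume "x \<in> {x. x \<noteq> 0 \<and> vec.span {x} \<in> A}"
    then show "x \<in> (\<Union>P\<in>A. P - {0})" using vec.span_base[of x "{x}"] by blast
  next
    fix x assume "x \<in> (\<Union>P\<in>A. P - {0})"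
    then obtain P where P: "P \<in> A" "x \<in> P" "x \<noteq> 0" by blast
    with A have "P = vec.span {x}" by (intro PG_point_eq_span) auto
    with P show "x \<in> {x. x \<noteq> 0 \<and> vec.span {x} \<in> A}" by simp
  qed
  moreover have "card (\<Union>P\<in>A. P - {0}) = (\<Sum>P\<in>A. card (P - {0}))"
  proof (rule card_UN_disjoint)
    show "\<forall>P\<in>A. \<forall>R\<in>A. P \<noteq> R \<longrightarrow> (P - {0}) \<inter> (R - {0}) = {}"
    proof (intro ballI impI)
      fix P R assume "P \<in> A" "R \<in> A" "P \<noteq> R"
      show "(P - {0}) \<inter> (R - {0}) = {}"
      proof (rule ccontr)
        assume "(P - {0}) \<inter> (R - {0}) \<noteq> {}"
        then obtain x where x: "x \<in> P" "x \<in> R" "x \<noteq> 0" by blast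
        have "P = vec.span {x}" using x A \<open>P \<in> A\<close> by (intro PG_point_eq_span) auto
        moreover have "R = vec.span {x}" using x A \<open>R \<in> A\<close> by (intro PG_point_eq_span) auto
        ultimately show False using \<open>P \<noteq> R\<close> by simp
      qed
    qed
  qed auto
  moreover have "card (P - {0}) = CARD('a) - 1" if "P \<in> A" for P
  proof -
    obtain v where v: "v \<noteq> 0" "P = vec.span {v}" using pt \<open>P \<in> A\<close> by blast
    then have "0 \<in> P" by (simp add: vec.span_zero)
    then show ?thesis using v card_span_singleton[OF v(1)] by (simp add: card_Diff_singleton)
  qed
  ultimately show ?thesis by simp
qed

section \<open>The weight gap of the code and the numerical bounds\<close>

lemma theta_times: "2 \<le> q \<Longrightarrow> (q - 1) * theta q k + 1 = q ^ (k + 1)"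
proof -
  assume "2 \<le> q"
  then obtain r where r: "q = Suc r" "r \<noteq> 0" by (cases q) auto
  have "Suc r ^ m = r * (\<Sum>i<m. Suc r ^ i) + 1" for m
    by (induction m) (simp_all add: algebra_simps)
  from this[of "k + 1"] show ?thesis unfolding theta_def r by (simp del: power_Suc)
qed

text \<open>Below 2q^k the associated function \<open>g\<close> falls under the Reed-Muller gap, so
  its weight is q^(k+1) = (q - 1) theta_k + 1, which is too small for a codeword heavier than
  theta_k.\<close>

lemma code_weight_gap:
  fixes c :: "('a::{finite,field} ^ 'n::finite) set \<Rightarrow> int"
  assumes p: "prime p" "CARD('a) = p ^ h" and n: "CARD('n) = n + 1" "k \<le> n"
    and q3: "3 \<le> CARD('a)" and c: "c \<in> code p k" and gt: "theta (CARD('a)) k < weight c"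
  shows "2 * CARD('a) ^ k \<le> weight c"
proof (rule ccontr)
  let ?q = "CARD('a)"
  assume "\<not> ?thesis"
  then have lt: "weight c + 1 \<le> 2 * ?q ^ k" by simp
  obtain a where ca: "\<And>P. P \<in> PG_points \<Longrightarrow>
      c P = (\<Sum>S\<in>PG_subspaces k. a S * incvec S P) mod int p"
    using c unfolding code_def by auto
  have "\<exists>f. pdeg UNIV ((n - k) * (?q - 1)) f \<and>
      (\<forall>x. x \<noteq> 0 \<longrightarrow> f (($) x) = of_int (incvec S (vec.span {x})))"
    if S: "S \<in> PG_subspaces k" for S :: "('a ^ 'n) set set"
  proof -
    obtain W where W: "S = {P \<in> PG_points. P \<subseteq> W}" "vec.subspace W" "vec.dim W = k + 1"
      using S unfolding PG_subspaces_def by blast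
    obtain f where f: "pdeg UNIV ((CARD('n) - vec.dim W) * (?q - 1)) f"
        "\<And>x. f (($) x) = (if x \<in> W then 1 else 0)"
      using pdeg_subspace_indicator[OF W(2)] by blast
    have "f (($) x) = of_int (incvec S (vec.span {x}))" if "x \<noteq> 0" for x
    proof -
      have "vec.span {x} \<in> PG_points" using that unfolding PG_points_def by blast
      moreover have "vec.span {x} \<subseteq> W \<longleftrightarrow> x \<in> W"
        using W(2) vec.span_base[of x "{x}"] vec.span_minimal[of "{x}" W] by blast
      ultimately show ?thesis unfolding f(2) incvec_def W(1) by simp
    qed
    moreover have "CARD('n) - vec.dim W = n - k" using n W(3) by simp
    ultimately show ?thesis using f(1) by auto
  qed
  then obtain F where F: "\<And>S. S \<in> PG_subspaces k \<Longrightarrow> pdeg UNIV ((n - k) * (?q - 1)) (F S)"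
    "\<And>S x. S \<in> PG_subspaces k \<Longrightarrow> x \<noteq> 0 \<Longrightarrow>
      F S (($) (x :: 'a ^ 'n)) = of_int (incvec S (vec.span {x}))"
    by metis
  define g where "g y = (\<Sum>S\<in>PG_subspaces k. of_int (a S) * F S y)" for y
  have "pdeg UNIV (0 + (n - k) * (?q - 1)) g"
    unfolding g_def by (intro pdeg_sum pdeg_mult pdeg.const F(1))
  then have deg: "pdeg UNIV ((n - k) * (?q - 1)) g" by simp
  \<comment> \<open>The integer sum vanishes in the field exactly when \<open>p\<close> divides it.
    The value of \<open>g\<close> at 0 is left open.\<close>
  have gx: "g (($) x) \<noteq> 0 \<longleftrightarrow> c (vec.span {x}) \<noteq> 0" if "x \<noteq> 0" for x
  proof -
    let ?s = "\<Sum>S\<in>PG_subspaces k. a S * incvec S (vec.span {x})"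
    have "g (($) x) = of_int ?s" unfolding g_def using F(2) that by simp
    moreover have "vec.span {x} \<in> PG_points" using that unfolding PG_points_def by blast
    ultimately show ?thesis
      using ca of_int_eq_0_iff_char_dvd[of ?s, where 'a = 'a] CHAR_eq_prime[OF p]
      by (simp add: mod_eq_0_iff_dvd)
  qed
  let ?X = "{x :: 'a ^ 'n. g (($) x) \<noteq> 0}"
  have wtg: "wt g = card ?X"
    by (rule bij_betw_same_card[of "vec_lambda"],
        rule bij_betw_byWitness[where f' = vec_nth]) (auto simp: vec_lambda_inverse)
  have "?X - {0} = {x. x \<noteq> 0 \<and> vec.span {x} \<in> {P \<in> PG_points. c P \<noteq> 0}}"
    using gx by (auto simp: PG_points_def)
  then have X: "card (?X - {0}) = (?q - 1) * weight c"
    unfolding weight_def by (simp only: card_cone[of "{P \<in> PG_points. c P \<noteq> 0}"] Collect_restrict)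
  have up: "wt g \<le> (?q - 1) * weight c + 1" and low: "(?q - 1) * weight c \<le> wt g"
    unfolding wtg X[symmetric] by (auto simp: card_Diff_singleton_if card_mono)
  obtain r where r: "?q = r + 3" using q3 by (metis le_Suc_ex add.commute)
  have "(?q - 1) * (weight c + 1) \<le> (?q - 1) * (2 * ?q ^ k)" using lt by (rule mult_le_mono2)
  \<comment> \<open>The possible extra nonzero at 0 is absorbed because q - 1 > 1.\<close>
  then have "wt g < 2 * (?q - 1) * ?q ^ k" using up unfolding r by (simp add: algebra_simps)
  then have "?q ^ (n - k + 1) * wt g < ?q ^ (n - k + 1) * (2 * (?q - 1) * ?q ^ k)" by simp
  also have "\<dots> = 2 * (?q - 1) * (?q ^ (n - k + 1) * ?q ^ k)" by (simp only: mult_ac)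
  also have "?q ^ (n - k + 1) * ?q ^ k = ?q ^ CARD('n)"
    unfolding power_add[symmetric] using n by simp
  finally have small: "?q ^ (n - k + 1) * wt g < 2 * (?q - 1) * ?q ^ CARD('n)" .
  have "0 < (?q - 1) * weight c" using gt q3 by simp
  then have "{y. g y \<noteq> 0} \<noteq> {}" using low by (metis card.empty not_le)
  then obtain y where "g y \<noteq> 0" by blast
  with second_weight[OF deg _ small] have "?q ^ (n - k) * wt g = ?q ^ CARD('n)" by blast
  also have "\<dots> = ?q ^ (n - k) * ?q ^ (k + 1)" unfolding power_add[symmetric] using n by simp
  finally have "wt g = ?q ^ (k + 1)" by simp
  moreover have "(?q - 1) * (theta ?q k + 1) \<le> (?q - 1) * weight c" using gt by (intro mult_le_mono2) simp
  moreover have "(?q - 1) * theta ?q k + 1 = ?q ^ (k + 1)" using q3 by (intro theta_times) simp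
  ultimately show False using low q3 unfolding distrib_left by linarith
qed

theorem mainTheorem5:
  fixes p h n k q :: nat
  assumes "prime p" and "h \<ge> 1" and "q = p ^ h"
    and "CARD('a::{finite,field}) = q"
    and "CARD('n::finite) = n + 1"
    and "n \<ge> 2" and "1 \<le> k" and "k \<le> n - 1"
  shows "(p = 7 \<longrightarrow>
           \<not> (\<exists>c \<in> (code p k :: (('a ^ 'n) set \<Rightarrow> int) set).
                 real (theta q k) < real (weight c) \<and>
                 real (weight c) < (12 * real (theta q k) + 2) / 7))
       \<and> (p > 7 \<longrightarrow>
           \<not> (\<exists>c \<in> (code p k :: (('a ^ 'n) set \<Rightarrow> int) set).
                 real (theta q k) < real (weight c) \<and>
                 real (weight c) < (12 * real (theta q k) + 6) / 7))"
proof -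
  have qp: "p \<le> q" using assms(1-3) by (metis prime_gt_0_nat self_le_power Suc_leI One_nat_def zero_less_one less_le_trans)
  have gap: "2 * real q ^ k \<le> real (weight c)"
    if "7 \<le> p" "c \<in> (code p k :: (('a ^ 'n) set \<Rightarrow> int) set)"
      "real (theta q k) < real (weight c)" for c
  proof -
    have "2 * CARD('a) ^ k \<le> weight c"
      using assms that qp by (intro code_weight_gap[of p h n k c]) auto
    then show ?thesis unfolding assms(4) by (metis of_nat_le_iff of_nat_mult of_nat_numeral of_nat_power)
  qed
  have theta: "(real q - 1) * real (theta q k) = real q * real q ^ k - 1" if "7 \<le> p"
  proof -
    have "real ((q - 1) * theta q k + 1) = real (q ^ (k + 1))"
      using that qp by (subst theta_times) auto
    then show ?thesis using that qp by (simp add: of_nat_diff)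
  qed
  have qk: "real q \<le> real q ^ k" if "7 \<le> p"
    using that qp assms(7) by (intro self_le_power) auto
  have "(12 * real (theta q k) + 2) / 7 \<le> 2 * real q ^ k" if "p = 7"
  proof -
    \<comment> \<open>Twice this product equals (q - 1)(14 q^k - 12 theta_k - 2).\<close>
    have "0 \<le> (real q - 7) * (real q ^ k - 1)" using that qp qk by (intro mult_nonneg_nonneg) auto
    then have "(real q - 1) * (12 * real (theta q k) + 2) \<le> (real q - 1) * (14 * real q ^ k)"
      using theta that by (simp add: algebra_simps)
    then have "12 * real (theta q k) + 2 \<le> 14 * real q ^ k"
      using that qp by (simp add: mult_le_cancel_left_pos)
    then show ?thesis by simp
  qed
  moreover have "(12 * real (theta q k) + 6) / 7 \<le> 2 * real q ^ k" if "p > 7"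
  proof -
    \<comment> \<open>Excluding 8 gives q at least 9, which the factor q - 9 below requires.\<close>
    have "p \<noteq> 8" using prime_odd_nat[OF assms(1)] by auto
    moreover have "p \<noteq> 8 \<longrightarrow> 9 \<le> p" using that by simp
    ultimately have q9: "9 \<le> real q" using qp by simp
    \<comment> \<open>Here (q - 1)(14 q^k - 12 theta_k - 6) = 2 ((q - 7) q^k - 3q + 9), and
      replacing q^k by q leaves 2 (q - 9)(q - 1).\<close>
    have "(real q - 7) * real q \<le> (real q - 7) * real q ^ k" using q9 qk that by (intro mult_left_mono) auto
    moreover have "0 \<le> (real q - 9) * (real q - 1)" using q9 by (intro mult_nonneg_nonneg) auto
    ultimately have "(real q - 1) * (12 * real (theta q k) + 6) \<le> (real q - 1) * (14 * real q ^ k)"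
      using theta that by (simp add: algebra_simps)
    then have "12 * real (theta q k) + 6 \<le> 14 * real q ^ k"
      using q9 by (simp add: mult_le_cancel_left_pos)
    then show ?thesis by simp
  qed
  ultimately show ?thesis using gap by (meson less_imp_le less_le_trans not_less order_refl)
qed

end
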